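(* Let $\zeta>1$, $\beta\in(0,1)$, $0<a<b$, and consider the Subbotin location model $X_i=\theta_i+\varepsilon_i$, $1\le i\le n$, with $\varepsilon_i$ i.i.d. of density $\phi_\zeta(x)=L_\zeta^{-1}e^{-|x|^\zeta/\zeta}$, and the classes $\Theta(r,\beta)$, $r>\beta$ (defined in the context). Suppose $r_1,r_2>\beta$ verify $$r_1>r_2\quad\text{and}\quad\kappa(r_2,\beta,\zeta)>1-\beta.$$ Then there exists $c>0$ (depending on $r_1,r_2,\beta,\zeta$) such that, for $n$ large enough, $$\inf_\varphi\ \max_{i\in\{1,2\}}\ \sup_{\theta\in\Theta(r_i,\beta)}\frac{\mathfrak R(\theta,\varphi)}{v_R(r_i,\beta,\zeta)}\ \ge\ c\,\Big[\{v_C(r_1,\beta,\zeta)^{-1}n^{-r_2}\}\wedge v_C(r_2,\beta,\zeta)^{-1}\Big],$$ where the infimum is over all multiple testing procedures. In particular, on the two-class adaptation problem $\theta\in\Theta(r_1,\beta)\cup\Theta(r_2,\beta)$, the best possible rate incurs a polynomial (in $n$) loss compared to the non-adaptive rate whenever $\kappa(r_1,\beta,\zeta)-r_2>1-\beta$ (that is, the left-hand side is then at least $n^{\eta}$ for some $\eta>0$ and all $n$ large). The same result holds for the classification risk, with $\mathfrak R/v_R$ in the display replaced by $E_\theta L_C/v_C$.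
   Context: $L_\zeta$ is the normalising constant. $\theta\in\mathbb R^n$ is deterministic; $P_\theta,E_\theta$ denote the law of $X$ and its expectation; $S_\theta=\{i:\theta_i\ne0\}$. With $M(r)=(\zeta r\log n)^{1/\zeta}$, $$\Theta(r,\beta)=\bigcup_{s_n\in[an^{1-\beta},\,bn^{1-\beta}]}\{\theta\in\mathbb R^n:\ |S_\theta|=s_n,\ |\theta_i|\ge M(r)\ \text{for all } i\in S_\theta\}$$ (union over integers $s_n$). For $r>\beta$, $\kappa=\kappa(r,\beta,\zeta)$ is the unique element of $(0,r/2^\zeta)$ with $(r^{1/\zeta}-\kappa^{1/\zeta})^\zeta-\kappa=\beta$, and $v_R(r,\beta,\zeta)=n^{-\kappa}/(\log n)^{1-1/\zeta}$, $v_C(r,\beta,\zeta)=n^{1-\beta}v_R(r,\beta,\zeta)$. A multiple testing procedure is a measurable $\varphi:\mathbb R^n\to\{0,1\}^n$. $\mathrm{FDR}(\theta,\varphi)=E_\theta\left[\frac{\sum_i\mathbf 1\{\theta_i=0\}\varphi_i(X)}{1\vee\sum_i\varphi_i(X)}\right]$, $\mathrm{FNR}(\theta,\varphi)=E_\theta\left[\frac{\sum_i\mathbf 1\{\theta_i\ne0\}(1-\varphi_i(X))}{1\vee|S_\theta|}\right]$, $\mathfrak R=\mathrm{FDR}+\mathrm{FNR}$; $L_C(\theta,\varphi)=\sum_{i=1}^n(\mathbf 1\{\theta_i=0\}\mathbf 1\{\varphi_i\ne0\}+\mathbf 1\{\theta_i\ne0\}\mathbf 1\{\varphi_i=0\})$.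 *)

theory Defs
  imports "HOL-Probability.Probability"
begin

text \<open>
  Vectors of \<open>\<real>\<^sup>n\<close> are extensional functions on \<open>{1..n}\<close>, since \<open>n\<close> is quantified inside
  the statements (asymptotics in \<open>n\<close>).
\<close>

definition subbotin_const :: "real \<Rightarrow> real" where
  "subbotin_const \<zeta> = (LBINT x. exp (- (\<bar>x\<bar> powr \<zeta>) / \<zeta>))"

definition subbotin_density :: "real \<Rightarrow> real \<Rightarrow> real" where
  "subbotin_density \<zeta> x = exp (- (\<bar>x\<bar> powr \<zeta>) / \<zeta>) / subbotin_const \<zeta>"

definition noise_law :: "real \<Rightarrow> nat \<Rightarrow> (nat \<Rightarrow> real) measure" where
  "noise_law \<zeta> n = (\<Pi>\<^sub>M i\<in>{1..n}. density lborel (\<lambda>x. ennreal (subbotin_density \<zeta> x)))"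

definition obs_law :: "real \<Rightarrow> nat \<Rightarrow> (nat \<Rightarrow> real) \<Rightarrow> (nat \<Rightarrow> real) measure" where
  "obs_law \<zeta> n \<theta> =
     distr (noise_law \<zeta> n) (\<Pi>\<^sub>M i\<in>{1..n}. borel) (\<lambda>\<epsilon>. \<lambda>i\<in>{1..n}. \<theta> i + \<epsilon> i)"

definition supp :: "nat \<Rightarrow> (nat \<Rightarrow> real) \<Rightarrow> nat set" where
  "supp n \<theta> = {i\<in>{1..n}. \<theta> i \<noteq> 0}"

definition signal_level :: "real \<Rightarrow> nat \<Rightarrow> real \<Rightarrow> real" where
  "signal_level \<zeta> n r = (\<zeta> * r * ln (real n)) powr (1 / \<zeta>)"

definition sparse_class ::
    "real \<Rightarrow> real \<Rightarrow> real \<Rightarrow> nat \<Rightarrow> real \<Rightarrow> real \<Rightarrow> (nat \<Rightarrow> real) set" where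
  "sparse_class \<zeta> a b n r \<beta> =
     (\<Union>s\<in>{s::nat. a * real n powr (1 - \<beta>) \<le> real s \<and> real s \<le> b * real n powr (1 - \<beta>)}.
        {\<theta> \<in> {1..n} \<rightarrow>\<^sub>E UNIV. card (supp n \<theta>) = s \<and>
           (\<forall>i\<in>supp n \<theta>. signal_level \<zeta> n r \<le> \<bar>\<theta> i\<bar>)})"

definition kappa :: "real \<Rightarrow> real \<Rightarrow> real \<Rightarrow> real" where
  "kappa r \<beta> \<zeta> = (THE k. k \<in> {0<..<r / 2 powr \<zeta>} \<and>
     (r powr (1 / \<zeta>) - k powr (1 / \<zeta>)) powr \<zeta> - k = \<beta>)"

lemma kappa_unique:
  fixes r \<beta> \<zeta> :: real
  assumes "\<zeta> > 1" "\<beta> > 0" "r > \<beta>"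
  shows "\<exists>!k. k \<in> {0<..<r / 2 powr \<zeta>} \<and>
     (r powr (1 / \<zeta>) - k powr (1 / \<zeta>)) powr \<zeta> - k = \<beta>"
proof -
  define f where "f k = (r powr (1 / \<zeta>) - k powr (1 / \<zeta>)) powr \<zeta> - k" for k
  define m where "m = r / 2 powr \<zeta>"
  have r: "r > 0" and z: "\<zeta> > 0" using assms by auto
  have m0: "m > 0" using r by (simp add: m_def)
  have m_root: "m powr (1 / \<zeta>) = r powr (1 / \<zeta>) / 2"
    using r z by (simp add: m_def powr_divide powr_powr)
  have half: "r powr (1 / \<zeta>) / 2 = r powr (1 / \<zeta>) - m powr (1 / \<zeta>)"
    using m_root by simp
  have f0: "f 0 = r" using r z by (simp add: f_def powr_powr)
  have fm: "f m = 0"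
    using m0 z by (simp add: f_def flip: half m_root) (simp add: powr_powr)
  have dec: "f y < f x" if "0 \<le> x" "x < y" "y \<le> m" for x y
  proof -
    have "x powr (1 / \<zeta>) \<le> y powr (1 / \<zeta>)" using that z by (intro powr_mono2) auto
    moreover have "y powr (1 / \<zeta>) \<le> m powr (1 / \<zeta>)" using that z by (intro powr_mono2) auto
    moreover have "y powr (1 / \<zeta>) \<ge> 0" by simp
    ultimately have "(r powr (1 / \<zeta>) - y powr (1 / \<zeta>)) powr \<zeta> \<le> (r powr (1 / \<zeta>) - x powr (1 / \<zeta>)) powr \<zeta>"
      using z m_root by (intro powr_mono2) linarith+
    then show ?thesis using that by (simp add: f_def)
  qed
  have "continuous_on {0..m} f"
  proof -
    have root_cont: "continuous_on {0..m} (\<lambda>k. k powr (1 / \<zeta>))"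
      using z by (intro continuous_on_powr' continuous_on_id continuous_on_const) auto
    have "k powr (1 / \<zeta>) \<le> r powr (1 / \<zeta>)" if "k \<in> {0..m}" for k
    proof -
      have "k powr (1 / \<zeta>) \<le> m powr (1 / \<zeta>)" using that z by (intro powr_mono2) auto
      then show ?thesis using m_root powr_ge_zero[of k "1 / \<zeta>"] by linarith
    qed
    then have "continuous_on {0..m} (\<lambda>k. (r powr (1 / \<zeta>) - k powr (1 / \<zeta>)) powr \<zeta>)"
      using z by (intro continuous_on_powr' continuous_on_diff root_cont continuous_on_const) auto
    then show ?thesis
      unfolding f_def by (intro continuous_on_diff continuous_on_id)
  qed
  then obtain k where k: "0 \<le> k" "k \<le> m" "f k = \<beta>"
    using IVT2'[of f m \<beta> 0] f0 fm assms m0 by auto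
  then have "0 < k" "k < m" using f0 fm assms by (auto simp: less_le)
  then show ?thesis
    using k dec unfolding f_def[symmetric] m_def[symmetric]
    by (intro ex1I[of _ k]) (auto, metis less_le not_less)
qed

definition rate_R :: "nat \<Rightarrow> real \<Rightarrow> real \<Rightarrow> real \<Rightarrow> real" where
  "rate_R n r \<beta> \<zeta> = real n powr (- kappa r \<beta> \<zeta>) / ln (real n) powr (1 - 1 / \<zeta>)"

definition rate_C :: "nat \<Rightarrow> real \<Rightarrow> real \<Rightarrow> real \<Rightarrow> real" where
  "rate_C n r \<beta> \<zeta> = real n powr (1 - \<beta>) * rate_R n r \<beta> \<zeta>"

definition procedures :: "nat \<Rightarrow> ((nat \<Rightarrow> real) \<Rightarrow> (nat \<Rightarrow> nat)) set" where
  "procedures n = (\<Pi>\<^sub>M i\<in>{1..n}. borel) \<rightarrow>\<^sub>M (\<Pi>\<^sub>M i\<in>{1..n}. count_space {0, 1})"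

definition FDR ::
    "real \<Rightarrow> nat \<Rightarrow> (nat \<Rightarrow> real) \<Rightarrow> ((nat \<Rightarrow> real) \<Rightarrow> (nat \<Rightarrow> nat)) \<Rightarrow> real" where
  "FDR \<zeta> n \<theta> \<phi> =
     (\<integral>x. (\<Sum>i=1..n. of_bool (\<theta> i = 0) * real (\<phi> x i)) / max 1 (\<Sum>i=1..n. real (\<phi> x i))
        \<partial>obs_law \<zeta> n \<theta>)"

definition FNR ::
    "real \<Rightarrow> nat \<Rightarrow> (nat \<Rightarrow> real) \<Rightarrow> ((nat \<Rightarrow> real) \<Rightarrow> (nat \<Rightarrow> nat)) \<Rightarrow> real" where
  "FNR \<zeta> n \<theta> \<phi> =
     (\<integral>x. (\<Sum>i=1..n. of_bool (\<theta> i \<noteq> 0) * (1 - real (\<phi> x i))) / max 1 (real (card (supp n \<theta>)))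
        \<partial>obs_law \<zeta> n \<theta>)"

definition risk_R ::
    "real \<Rightarrow> nat \<Rightarrow> (nat \<Rightarrow> real) \<Rightarrow> ((nat \<Rightarrow> real) \<Rightarrow> (nat \<Rightarrow> nat)) \<Rightarrow> real" where
  "risk_R \<zeta> n \<theta> \<phi> = FDR \<zeta> n \<theta> \<phi> + FNR \<zeta> n \<theta> \<phi>"

definition loss_C :: "nat \<Rightarrow> (nat \<Rightarrow> real) \<Rightarrow> (nat \<Rightarrow> nat) \<Rightarrow> real" where
  "loss_C n \<theta> d =
     (\<Sum>i=1..n. of_bool (\<theta> i = 0) * of_bool (d i \<noteq> 0) + of_bool (\<theta> i \<noteq> 0) * of_bool (d i = 0))"

definition risk_C ::
    "real \<Rightarrow> nat \<Rightarrow> (nat \<Rightarrow> real) \<Rightarrow> ((nat \<Rightarrow> real) \<Rightarrow> (nat \<Rightarrow> nat)) \<Rightarrow> real" where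
  "risk_C \<zeta> n \<theta> \<phi> = (\<integral>x. loss_C n \<theta> (\<phi> x) \<partial>obs_law \<zeta> n \<theta>)"

end

theory Submission
  imports Defs "HOL-Real_Asymp.Real_Asymp"
begin

text \<open>
  Two parameters suffice: \<open>\<theta>\<^sub>1\<close> has all its signals at level \<open>M(r\<^sub>1)\<close>, and \<open>\<theta>\<^sub>2\<close> adds to it one
  coordinate \<open>i\<close> at the smaller level \<open>M(r\<^sub>2)\<close>. A risk of order \<open>v\<^sub>R / v\<^sub>C = n\<^sup>\<beta>\<^sup>-\<^sup>1\<close> at \<open>\<theta>\<^sub>2\<close>
  is what a single mistake costs, so a procedure doing better must reject at \<open>i\<close> with large
  \<open>\<theta>\<^sub>2\<close>-probability. On an event of probability bounded below (noise at \<open>i\<close> in \<open>[-1,0]\<close>) the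
  likelihood ratio of \<open>\<theta>\<^sub>1\<close> against \<open>\<theta>\<^sub>2\<close> is at least \<open>exp (- M(r\<^sub>2) powr \<zeta> / \<zeta>) = n powr (- r\<^sub>2)\<close>,
  so it then also rejects wrongly at \<open>i\<close> under \<open>\<theta>\<^sub>1\<close>, with probability of order \<open>n powr (- r\<^sub>2)\<close>.
\<close>

section \<open>The Subbotin distribution on the line\<close>

abbreviation subbotin :: "real \<Rightarrow> real measure" where
  "subbotin \<zeta> \<equiv> density lborel (\<lambda>x. ennreal (subbotin_density \<zeta> x))"

text \<open>Domination by the exponential density plus its reflection: on each half line one of the
  two equals the integrand.\<close>

lemma integrable_exp_neg_abs: "integrable lborel (\<lambda>x::real. exp (- \<bar>x\<bar>))"
proof -
  interpret prob_space "density lborel (exponential_density 1)"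
    by (rule prob_space_exponential_density) simp
  have nn: "exponential_density 1 x \<ge> 0" for x :: real
    by (simp add: exponential_density_def)
  have "(\<integral>\<^sup>+ x. ennreal (exponential_density 1 x) \<partial>lborel) = 1"
    using emeasure_space_1 by (simp add: emeasure_density)
  then have i1: "integrable lborel (\<lambda>x::real. exponential_density 1 x)"
    by (intro integrableI_nonneg) (auto simp: nn)
  have i2: "integrable lborel (\<lambda>x::real. exponential_density 1 (- x))"
    using lborel_integrable_real_affine[OF i1, of "-1" 0] by simp
  show ?thesis
    by (rule Bochner_Integration.integrable_bound[OF Bochner_Integration.integrable_add[OF i1 i2]])
      (auto simp: exponential_density_def)
qed

text \<open>Young's inequality for \<open>\<bar>x\<bar> * 1\<close> with the conjugate exponents
  \<open>\<zeta>\<close> and \<open>\<zeta> / (\<zeta> - 1)\<close> bounds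
  \<open>\<bar>x\<bar>\<close> by \<open>\<bar>x\<bar> powr \<zeta> / \<zeta> + 1\<close>, so
  \<open>exp 1 * exp (- \<bar>x\<bar>)\<close> dominates the kernel.\<close>

lemma integrable_subbotin_kernel:
  fixes \<zeta> :: real
  assumes "\<zeta> > 1"
  shows "integrable lborel (\<lambda>x. exp (- (\<bar>x\<bar> powr \<zeta>) / \<zeta>))"
proof -
  have "\<bar>x\<bar> \<le> \<bar>x\<bar> powr \<zeta> / \<zeta> + 1" for x :: real
  proof -
    have "\<bar>x\<bar> * 1 \<le> \<bar>x\<bar> powr \<zeta> / \<zeta> + 1 powr (\<zeta> / (\<zeta> - 1)) / (\<zeta> / (\<zeta> - 1))"
      using assms by (intro Youngs_inequality) (auto simp: field_simps)
    also have "1 powr (\<zeta> / (\<zeta> - 1)) / (\<zeta> / (\<zeta> - 1)) \<le> 1"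
      using assms by (simp add: field_simps)
    finally show ?thesis by simp
  qed
  then have "exp (- (\<bar>x\<bar> powr \<zeta>) / \<zeta>) \<le> exp 1 * exp (- \<bar>x\<bar>)" for x :: real
    by (simp flip: exp_add) (smt (verit))
  then show ?thesis
    by (intro Bochner_Integration.integrable_bound
        [OF integrable_mult_right[OF integrable_exp_neg_abs, of "exp 1"]]) auto
qed

text \<open>A strictly positive integrable function cannot have integral 0, for then the whole line
  would be a null set. Integrability rules out that 0 is just the default value of the
  integral.\<close>

lemma subbotin_const_pos:
  assumes "\<zeta> > 1"
  shows "subbotin_const \<zeta> > 0"
proof -
  have "(LBINT x. exp (- (\<bar>x\<bar> powr \<zeta>) / \<zeta>)) \<noteq> 0"
  proof
    assume "(LBINT x. exp (- (\<bar>x\<bar> powr \<zeta>) / \<zeta>)) = 0"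
    then have "AE x in lborel. exp (- (\<bar>x\<bar> powr \<zeta>) / \<zeta>) = 0"
      using integral_nonneg_eq_0_iff_AE[OF integrable_subbotin_kernel[OF assms]] by simp
    then have "AE x in lborel. x \<notin> (UNIV :: real set)" by simp
    then have "(UNIV :: real set) \<in> null_sets lborel"
      by (subst (asm) AE_iff_null_sets[symmetric]) auto
    then show False by (simp add: null_sets_def)
  qed
  moreover have "(LBINT x. exp (- (\<bar>x\<bar> powr \<zeta>) / \<zeta>)) \<ge> 0"
    by (rule integral_nonneg_AE) simp
  ultimately show ?thesis unfolding subbotin_const_def by linarith
qed

lemma subbotin_density_pos: "\<zeta> > 1 \<Longrightarrow> subbotin_density \<zeta> x > 0"
  by (simp add: subbotin_density_def subbotin_const_pos)

lemma subbotin_density_measurable [measurable]: "subbotin_density \<zeta> \<in> borel_measurable borel"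
  unfolding subbotin_density_def by measurable

lemma prob_space_subbotin:
  assumes "\<zeta> > 1"
  shows "prob_space (subbotin \<zeta>)"
proof
  have "(\<integral>\<^sup>+ x. ennreal (subbotin_density \<zeta> x) \<partial>lborel) = ennreal (LBINT x. subbotin_density \<zeta> x)"
    unfolding subbotin_density_def using assms
    by (intro nn_integral_eq_integral integrable_divide integrable_subbotin_kernel)
      (auto simp: subbotin_const_pos less_imp_le)
  also have "(LBINT x. subbotin_density \<zeta> x) = 1"
    using subbotin_const_pos[OF assms]
    by (simp add: subbotin_density_def) (simp add: subbotin_const_def)
  finally show "emeasure (subbotin \<zeta>) (space (subbotin \<zeta>)) = 1"
    by (simp add: emeasure_density)
qed

text \<open>Applied to \<open>{-1..0}\<close>, this makes the constants of both lower bounds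
  positive.\<close>

lemma subbotin_interval_pos:
  fixes \<zeta> s t :: real
  assumes "\<zeta> > 1" "s < t"
  shows "measure (subbotin \<zeta>) {s..t} > 0"
proof -
  interpret prob_space "subbotin \<zeta>" by (rule prob_space_subbotin) fact
  have "emeasure (subbotin \<zeta>) {s..t} \<noteq> 0"
  proof
    assume "emeasure (subbotin \<zeta>) {s..t} = 0"
    then have "AE x in lborel. ennreal (subbotin_density \<zeta> x) * indicator {s..t} x = 0"
      by (simp add: emeasure_density nn_integral_0_iff_AE)
    then have "AE x in lborel. x \<notin> {s..t}"
    proof eventually_elim
      case (elim x)
      then show ?case
        using subbotin_density_pos[OF assms(1), of x] by (auto simp: indicator_def ennreal_eq_0_iff)
    qed
    then have "{s..t} \<in> null_sets lborel"
      by (subst (asm) AE_iff_null_sets[symmetric]) auto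
    then show False using assms(2) by (auto simp: null_sets_def)
  qed
  then show ?thesis
    by (simp add: emeasure_eq_measure zero_less_measure_iff)
qed

text \<open>The one-dimensional change of measure. For noise \<open>y\<close> in
  \<open>{-1..0}\<close> the point \<open>m + y\<close> lies in \<open>{0..m}\<close>, so the
  density there is at least \<open>exp (- (m powr \<zeta>) / \<zeta>)\<close> over the normalising
  constant, while the density at \<open>y\<close> is at most 1 over it. Noise outside the interval
  is paid for by its probability, through \<open>g \<le> 1\<close>. Later \<open>g\<close> is a
  section of the indicator of a rejection event.\<close>

lemma subbotin_shift_le:
  fixes \<zeta> m :: real and g :: "real \<Rightarrow> ennreal"
  assumes \<zeta>: "\<zeta> > 1" and m: "m \<ge> 1"
    and g [measurable]: "g \<in> borel_measurable borel" and g1: "\<And>x. g x \<le> 1"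
  shows "ennreal (exp (- (m powr \<zeta>) / \<zeta>)) * (\<integral>\<^sup>+ y. g (m + y) \<partial>subbotin \<zeta>)
    \<le> (\<integral>\<^sup>+ y. g y \<partial>subbotin \<zeta>)
      + ennreal (exp (- (m powr \<zeta>) / \<zeta>) * (1 - measure (subbotin \<zeta>) {-1..0}))"
proof -
  interpret prob_space "subbotin \<zeta>" by (rule prob_space_subbotin) fact
  let ?f = "\<lambda>x. ennreal (subbotin_density \<zeta> x)"
  let ?e = "exp (- (m powr \<zeta>) / \<zeta>)"
  have "(\<integral>\<^sup>+ y. g (m + y) \<partial>subbotin \<zeta>)
      \<le> (\<integral>\<^sup>+ y. g (m + y) * indicator {-1..0} y + indicator (UNIV - {-1..0}) y \<partial>subbotin \<zeta>)"
    using g1 by (intro nn_integral_mono) (auto simp: indicator_def)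
  also have "\<dots> = (\<integral>\<^sup>+ y. g (m + y) * indicator {-1..0} y \<partial>subbotin \<zeta>)
      + emeasure (subbotin \<zeta>) (UNIV - {-1..0})"
    by (subst nn_integral_add) auto
  also have "emeasure (subbotin \<zeta>) (UNIV - {-1..0}) = ennreal (1 - measure (subbotin \<zeta>) {-1..0})"
    using prob_compl[of "{-1..0}"] by (simp add: emeasure_eq_measure)
  finally have 1: "ennreal ?e * (\<integral>\<^sup>+ y. g (m + y) \<partial>subbotin \<zeta>)
     \<le> ennreal ?e * (\<integral>\<^sup>+ y. g (m + y) * indicator {-1..0} y \<partial>subbotin \<zeta>)
       + ennreal ?e * ennreal (1 - measure (subbotin \<zeta>) {-1..0})"
    by (simp add: distrib_left[symmetric] mult_left_mono)
  have "(\<integral>\<^sup>+ y. g (m + y) * indicator {-1..0} y \<partial>subbotin \<zeta>)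
      = (\<integral>\<^sup>+ y. ?f y * (g (m + y) * indicator {-1..0} y) \<partial>lborel)"
    by (simp add: nn_integral_density)
  \<comment> \<open>Translating by \<open>m\<close> puts the same factor \<open>g y\<close> into
    both integrals, leaving a pointwise comparison of densities.\<close>
  also have "\<dots> = (\<integral>\<^sup>+ y. ?f (y - m) * (g y * indicator {-1..0} (y - m)) \<partial>lborel)"
    by (subst nn_integral_real_affine[of _ 1 "-m"]) (auto simp: algebra_simps)
  finally have "ennreal ?e * (\<integral>\<^sup>+ y. g (m + y) * indicator {-1..0} y \<partial>subbotin \<zeta>)
      = (\<integral>\<^sup>+ y. ennreal ?e * (?f (y - m) * (g y * indicator {-1..0} (y - m))) \<partial>lborel)"
    by (simp add: nn_integral_cmult)
  also have "\<dots> \<le> (\<integral>\<^sup>+ y. ?f y * g y \<partial>lborel)"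
  proof (intro nn_integral_mono)
    fix y :: real
    show "ennreal ?e * (?f (y - m) * (g y * indicator {-1..0} (y - m))) \<le> ?f y * g y"
    proof (cases "y - m \<in> {-1..0}")
      case True
      \<comment> \<open>Here \<open>m \<ge> 1\<close> enters: \<open>y \<ge> m - 1 \<ge> 0\<close>,
        hence \<open>\<bar>y\<bar> = y \<le> m\<close>.\<close>
      then have "\<bar>y\<bar> powr \<zeta> \<le> m powr \<zeta>"
        using m \<zeta> by (intro powr_mono2) auto
      then have "exp (- (m powr \<zeta>) / \<zeta>) \<le> exp (- (\<bar>y\<bar> powr \<zeta>) / \<zeta>)"
        using \<zeta> by (simp add: divide_right_mono)
      moreover have "exp (- (\<bar>y - m\<bar> powr \<zeta>) / \<zeta>) \<le> 1"
        using \<zeta> by simp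
      ultimately have "?e * exp (- (\<bar>y - m\<bar> powr \<zeta>) / \<zeta>) \<le> exp (- (\<bar>y\<bar> powr \<zeta>) / \<zeta>) * 1"
        by (intro mult_mono) auto
      then have "?e * subbotin_density \<zeta> (y - m) \<le> subbotin_density \<zeta> y"
        using subbotin_const_pos[OF \<zeta>]
        by (simp add: subbotin_density_def divide_right_mono)
      then have "ennreal ?e * ?f (y - m) \<le> ?f y"
        by (simp add: ennreal_leI flip: ennreal_mult')
      then have "(ennreal ?e * ?f (y - m)) * g y \<le> ?f y * g y"
        by (rule mult_right_mono) simp
      then show ?thesis using True by (simp add: mult.assoc)
    qed auto
  qed
  also have "\<dots> = (\<integral>\<^sup>+ y. g y \<partial>subbotin \<zeta>)"
    by (simp add: nn_integral_density)
  finally show ?thesis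
    using 1 by (simp add: ennreal_mult') (meson add_right_mono order_trans)
qed

section \<open>The law of the observations and the effect of one added signal\<close>

lemma sets_obs_law [measurable_cong]: "sets (obs_law \<zeta> n \<theta>) = sets (\<Pi>\<^sub>M i\<in>{1..n}. borel)"
  by (simp add: obs_law_def)

lemma shift_measurable [measurable]:
  "(\<lambda>\<epsilon>. \<lambda>i\<in>{1..n}. \<theta> i + \<epsilon> i) \<in> noise_law \<zeta> n \<rightarrow>\<^sub>M (\<Pi>\<^sub>M i\<in>{1..n}. (borel :: real measure))"
  unfolding noise_law_def
  by (intro measurable_restrict borel_measurable_add measurable_const)
    (auto intro: measurable_compose[OF measurable_component_singleton])

lemma prob_space_obs_law:
  assumes "\<zeta> > 1"
  shows "prob_space (obs_law \<zeta> n \<theta>)"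
proof -
  interpret prob_space "subbotin \<zeta>" by (rule prob_space_subbotin) fact
  interpret product_prob_space "\<lambda>_::nat. subbotin \<zeta>" by unfold_locales
  have "prob_space (noise_law \<zeta> n)"
    unfolding noise_law_def by (rule prob_space_PiM) unfold_locales
  then show ?thesis
    unfolding obs_law_def by (rule prob_space.prob_space_distr) measurable
qed

text \<open>Tonelli with the noise at \<open>i\<close> innermost and all other coordinates frozen,
  so that a comparison on the line can be applied inside the outer integral.\<close>

lemma emeasure_obs_law_coordinate:
  assumes \<zeta>: "\<zeta> > 1" and i: "i \<in> {1..n}" and A: "A \<in> sets (\<Pi>\<^sub>M i\<in>{1..n}. borel)"
  shows "emeasure (obs_law \<zeta> n \<theta>) A =
    (\<integral>\<^sup>+ x. (\<integral>\<^sup>+ y. indicator A (\<lambda>j\<in>{1..n}. if j = i then \<theta> i + y else \<theta> j + x j) \<partial>subbotin \<zeta>)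
       \<partial>(\<Pi>\<^sub>M j\<in>{1..n} - {i}. subbotin \<zeta>))"
proof -
  interpret prob_space "subbotin \<zeta>" by (rule prob_space_subbotin) fact
  interpret product_sigma_finite "\<lambda>_::nat. subbotin \<zeta>" by unfold_locales
  have eq: "insert i ({1..n} - {i}) = {1..n}" using i by auto
  have "emeasure (obs_law \<zeta> n \<theta>) A = (\<integral>\<^sup>+ z. indicator A z \<partial>obs_law \<zeta> n \<theta>)"
    using A by (subst nn_integral_indicator) (auto simp: sets_obs_law)
  also have "\<dots> = (\<integral>\<^sup>+ \<epsilon>. indicator A (\<lambda>j\<in>{1..n}. \<theta> j + \<epsilon> j) \<partial>noise_law \<zeta> n)"
    unfolding obs_law_def using A by (intro nn_integral_distr shift_measurable) auto
  also have "\<dots> = (\<integral>\<^sup>+ \<epsilon>. indicator A (\<lambda>j\<in>{1..n}. \<theta> j + \<epsilon> j)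
      \<partial>(\<Pi>\<^sub>M j\<in>insert i ({1..n} - {i}). subbotin \<zeta>))"
    by (simp only: eq noise_law_def)
  also have "\<dots> = (\<integral>\<^sup>+ x. (\<integral>\<^sup>+ y. indicator A (\<lambda>j\<in>{1..n}. \<theta> j + (x(i := y)) j) \<partial>subbotin \<zeta>)
       \<partial>(\<Pi>\<^sub>M j\<in>{1..n} - {i}. subbotin \<zeta>))"
    by (subst product_nn_integral_insert)
      (use A shift_measurable[where \<theta> = \<theta> and n = n and \<zeta> = \<zeta>] in \<open>auto simp: eq noise_law_def\<close>)
  also have "\<dots> = (\<integral>\<^sup>+ x. (\<integral>\<^sup>+ y. indicator A (\<lambda>j\<in>{1..n}. if j = i then \<theta> i + y else \<theta> j + x j)
       \<partial>subbotin \<zeta>) \<partial>(\<Pi>\<^sub>M j\<in>{1..n} - {i}. subbotin \<zeta>))"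
    by (intro nn_integral_cong arg_cong[where f = "indicator A"] restrict_ext) auto
  finally show ?thesis .
qed

text \<open>The shift inequality is integrated over the noise of the other coordinates, with
  \<open>g z\<close> the indicator of \<open>A\<close> at the vector whose entry at \<open>i\<close>
  is \<open>z\<close>. As \<open>\<theta> i = 0\<close>, this entry is the bare noise under
  \<open>\<theta>\<close> and the noise translated by \<open>m\<close> under
  \<open>\<theta>(i := m)\<close>; no other entry differs. Much of the proof is joint
  measurability.\<close>

lemma obs_law_add_signal:
  assumes \<zeta>: "\<zeta> > 1" and i: "i \<in> {1..n}" and A: "A \<in> sets (\<Pi>\<^sub>M i\<in>{1..n}. borel)"
    and null: "\<theta> i = 0" and m: "m \<ge> 1"
  shows "exp (- (m powr \<zeta>) / \<zeta>) * measure (obs_law \<zeta> n (\<theta>(i := m))) A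
    \<le> measure (obs_law \<zeta> n \<theta>) A + exp (- (m powr \<zeta>) / \<zeta>) * (1 - measure (subbotin \<zeta>) {-1..0})"
proof -
  interpret S: prob_space "subbotin \<zeta>" by (rule prob_space_subbotin) fact
  interpret P: prob_space "\<Pi>\<^sub>M j\<in>{1..n} - {i}. subbotin \<zeta>"
    by (rule prob_space_PiM) unfold_locales
  interpret O1: prob_space "obs_law \<zeta> n \<theta>" by (rule prob_space_obs_law) fact
  interpret O2: prob_space "obs_law \<zeta> n (\<theta>(i := m))" by (rule prob_space_obs_law) fact
  let ?e = "exp (- (m powr \<zeta>) / \<zeta>)"
  let ?q = "1 - measure (subbotin \<zeta>) {-1..0}"
  let ?P = "\<Pi>\<^sub>M j\<in>{1..n} - {i}. subbotin \<zeta>"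
  let ?g = "\<lambda>x z. indicator A (\<lambda>j\<in>{1..n}. if j = i then z else \<theta> j + x j) :: ennreal"
  \<comment> \<open>The map \<open>h\<close> is kept general to cover both parameters: the identity
    for \<open>\<theta>\<close>, the translation by \<open>m\<close> for
    \<open>\<theta>(i := m)\<close>.\<close>
  have vec: "(\<lambda>(x, z). \<lambda>j\<in>{1..n}. if j = i then h z else \<theta> j + x j)
      \<in> ?P \<Otimes>\<^sub>M borel \<rightarrow>\<^sub>M (\<Pi>\<^sub>M i\<in>{1..n}. borel)" if [measurable]: "h \<in> borel_measurable borel" for h :: "real \<Rightarrow> real"
  proof -
    have "(\<lambda>w. if j = i then h (snd w) else \<theta> j + fst w j) \<in> borel_measurable (?P \<Otimes>\<^sub>M borel)"
      if "j \<in> {1..n}" for j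
    proof (cases "j = i")
      case False
      then have "(\<lambda>x. x j) \<in> ?P \<rightarrow>\<^sub>M subbotin \<zeta>"
        using that by (intro measurable_component_singleton) auto
      then have [measurable]: "(\<lambda>x. x j) \<in> borel_measurable ?P" by simp
      show ?thesis unfolding if_not_P[OF False] by measurable
    qed simp
    then show ?thesis by (auto simp: case_prod_beta intro!: measurable_restrict)
  qed
  have G: "(\<lambda>(x, z). ?g x (h z)) \<in> borel_measurable (?P \<Otimes>\<^sub>M borel)"
    if "h \<in> borel_measurable borel" for h :: "real \<Rightarrow> real"
    using measurable_compose[OF vec[OF that] borel_measurable_indicator[OF A]]
    unfolding case_prod_beta' .
  have G': "(\<lambda>(x, z). ?g x (h z)) \<in> borel_measurable (?P \<Otimes>\<^sub>M subbotin \<zeta>)"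
    if "h \<in> borel_measurable borel" for h :: "real \<Rightarrow> real"
    using G[OF that] by (simp cong: measurable_cong_sets sets_pair_measure_cong)
  have inner [measurable]: "(\<lambda>x. \<integral>\<^sup>+ y. ?g x (h y) \<partial>subbotin \<zeta>) \<in> borel_measurable ?P"
    if "h \<in> borel_measurable borel" for h :: "real \<Rightarrow> real"
    using S.borel_measurable_nn_integral[OF G'[OF that]] by simp
  have i1 [measurable]: "(\<lambda>x. \<integral>\<^sup>+ y. ?g x y \<partial>subbotin \<zeta>) \<in> borel_measurable ?P"
    using inner[of "\<lambda>y. y"] by simp
  have i2 [measurable]: "(\<lambda>x. \<integral>\<^sup>+ y. ?g x (m + y) \<partial>subbotin \<zeta>) \<in> borel_measurable ?P"
    using inner[of "\<lambda>y. m + y"] by simp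
  have e1: "emeasure (obs_law \<zeta> n \<theta>) A = (\<integral>\<^sup>+ x. (\<integral>\<^sup>+ y. ?g x y \<partial>subbotin \<zeta>) \<partial>?P)"
    unfolding emeasure_obs_law_coordinate[OF \<zeta> i A, of \<theta>] null add_0 ..
  have "emeasure (obs_law \<zeta> n (\<theta>(i := m))) A = (\<integral>\<^sup>+ x. (\<integral>\<^sup>+ y.
      indicator A (\<lambda>j\<in>{1..n}. if j = i then (\<theta>(i := m)) i + y else (\<theta>(i := m)) j + x j)
      \<partial>subbotin \<zeta>) \<partial>?P)"
    by (rule emeasure_obs_law_coordinate[OF \<zeta> i A])
  also have "\<dots> = (\<integral>\<^sup>+ x. (\<integral>\<^sup>+ y. ?g x (m + y) \<partial>subbotin \<zeta>) \<partial>?P)"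
    by (intro nn_integral_cong arg_cong[where f = "indicator A"] restrict_ext) auto
  finally have "ennreal ?e * emeasure (obs_law \<zeta> n (\<theta>(i := m))) A
      = (\<integral>\<^sup>+ x. ennreal ?e * (\<integral>\<^sup>+ y. ?g x (m + y) \<partial>subbotin \<zeta>) \<partial>?P)"
    by (simp only: nn_integral_cmult[OF i2])
  also have "\<dots> \<le> (\<integral>\<^sup>+ x. (\<integral>\<^sup>+ y. ?g x y \<partial>subbotin \<zeta>) + ennreal (?e * ?q) \<partial>?P)"
  proof (intro nn_integral_mono subbotin_shift_le[OF \<zeta> m])
    fix x assume "x \<in> space ?P"
    then show "?g x \<in> borel_measurable borel"
      using measurable_Pair2[OF G[of "\<lambda>z. z"]] by simp
  qed (simp add: indicator_def)
  also have "\<dots> = emeasure (obs_law \<zeta> n \<theta>) A + ennreal (?e * ?q)"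
    by (subst nn_integral_add[OF i1]) (simp_all only: e1 nn_integral_const P.emeasure_space_1
        mult_1_right measurable_const space_borel UNIV_I)
  finally have "ennreal (?e * measure (obs_law \<zeta> n (\<theta>(i := m))) A)
      \<le> ennreal (measure (obs_law \<zeta> n \<theta>) A + ?e * ?q)"
    by (simp add: O1.emeasure_eq_measure O2.emeasure_eq_measure ennreal_mult')
  moreover have "0 \<le> measure (obs_law \<zeta> n \<theta>) A + ?e * ?q" by simp
  ultimately show ?thesis
    by (simp only: ennreal_le_iff)
qed

text \<open>The mass \<open>p\<close> of the favourable noise is split in half between the two
  errors. With \<open>e\<close> the exponential factor, failure of the second alternative bounds
  \<open>e\<close> times the probability of \<open>A\<close> under \<open>\<theta>(i := m)\<close>
  by \<open>e * (p / 2) + e * (1 - p) = e * (1 - p / 2)\<close>, strictly; cancelling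
  \<open>e\<close> and passing to the complement gives the first.\<close>

lemma obs_law_error_dichotomy:
  assumes \<zeta>: "\<zeta> > 1" and i: "i \<in> {1..n}" and A: "A \<in> sets (\<Pi>\<^sub>M i\<in>{1..n}. borel)"
    and null: "\<theta> i = 0" and m: "m \<ge> 1"
  defines "p \<equiv> measure (subbotin \<zeta>) {-1..0}"
  shows "p / 2 \<le> measure (obs_law \<zeta> n (\<theta>(i := m))) (space (obs_law \<zeta> n (\<theta>(i := m))) - A)
    \<or> exp (- (m powr \<zeta>) / \<zeta>) * (p / 2) \<le> measure (obs_law \<zeta> n \<theta>) A"
proof (rule disjCI)
  interpret O2: prob_space "obs_law \<zeta> n (\<theta>(i := m))" by (rule prob_space_obs_law) fact
  let ?e = "exp (- (m powr \<zeta>) / \<zeta>)"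
  assume "\<not> ?e * (p / 2) \<le> measure (obs_law \<zeta> n \<theta>) A"
  then have "?e * measure (obs_law \<zeta> n (\<theta>(i := m))) A < ?e * (1 - p / 2)"
    using obs_law_add_signal[where m = m and \<theta> = \<theta>, OF \<zeta> i A null m] by (simp add: p_def algebra_simps)
  then have "measure (obs_law \<zeta> n (\<theta>(i := m))) A < 1 - p / 2" by simp
  then show "p / 2 \<le> O2.prob (space (obs_law \<zeta> n (\<theta>(i := m))) - A)"
    using O2.prob_compl[of A] A by (simp add: sets_obs_law)
qed

section \<open>Procedures and their rejection events\<close>

lemma procedures_measurable:
  fixes h :: "nat \<Rightarrow> real"
  assumes "\<phi> \<in> procedures n" "i \<in> {1..n}"
  shows "(\<lambda>x. h (\<phi> x i)) \<in> borel_measurable (\<Pi>\<^sub>M i\<in>{1..n}. borel)"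
proof -
  have "\<phi> \<in> (\<Pi>\<^sub>M i\<in>{1..n}. borel) \<rightarrow>\<^sub>M (\<Pi>\<^sub>M i\<in>{1..n}. count_space {0, 1})"
    using assms(1) by (simp add: procedures_def)
  from measurable_compose[OF this measurable_component_singleton[OF assms(2)]]
  show ?thesis by (rule measurable_compose) simp
qed

lemma procedures_cases:
  assumes "\<phi> \<in> procedures n" "i \<in> {1..n}" "x \<in> space (obs_law \<zeta> n \<theta>)"
  shows "\<phi> x i = 0 \<or> \<phi> x i = 1"
proof -
  have "\<phi> x \<in> space (\<Pi>\<^sub>M i\<in>{1..n}. count_space {0, 1 :: nat})"
    using assms by (intro measurable_space[of \<phi> "\<Pi>\<^sub>M i\<in>{1..n}. borel"])
      (auto simp: procedures_def obs_law_def)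
  then show ?thesis using assms(2) by (auto simp: space_PiM)
qed

text \<open>A Markov-type bound. The upper bound \<open>B\<close> serves only to make
  \<open>f\<close> integrable, so that its expectation is not the default value 0.\<close>

lemma (in prob_space) expectation_ge_prob:
  fixes f :: "'a \<Rightarrow> real"
  assumes f: "f \<in> borel_measurable M" and A: "A \<in> events"
    and nonneg: "\<And>x. x \<in> space M \<Longrightarrow> 0 \<le> f x" and bound: "\<And>x. x \<in> space M \<Longrightarrow> f x \<le> B"
    and ge: "\<And>x. x \<in> A \<Longrightarrow> k \<le> f x"
  shows "k * prob A \<le> expectation f"
proof -
  have "k * prob A = expectation (\<lambda>x. k * indicator A x)"
    using A sets.sets_into_space[OF A] by (simp add: Int_absorb1)
  also have "\<dots> \<le> expectation f"
  proof (rule integral_mono)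
    show "integrable M (\<lambda>x. k * indicator A x)"
      using A by (intro integrable_mult_right integrable_real_indicator)
        (auto simp: emeasure_eq_measure less_top[symmetric])
    show "integrable M f"
      using f nonneg bound by (intro integrable_const_bound[where B = B]) auto
    show "k * indicator A x \<le> f x" if "x \<in> space M" for x
      using ge[of x] nonneg[OF that] by (auto simp: indicator_def)
  qed
  finally show ?thesis .
qed

text \<open>Both \<open>\<zeta>\<close> and \<open>\<theta>\<close> enter only through the sample
  space, which does not vary with them; the events for two parameters are therefore the same
  set.\<close>

definition rejected :: "real \<Rightarrow> nat \<Rightarrow> (nat \<Rightarrow> real) \<Rightarrow> ((nat \<Rightarrow> real) \<Rightarrow> nat \<Rightarrow> nat) \<Rightarrow> nat
    \<Rightarrow> (nat \<Rightarrow> real) set" where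
  "rejected \<zeta> n \<theta> \<phi> i = {x \<in> space (obs_law \<zeta> n \<theta>). \<phi> x i \<noteq> 0}"

lemma rejected_measurable:
  assumes "\<phi> \<in> procedures n" "i \<in> {1..n}"
  shows "rejected \<zeta> n \<theta> \<phi> i \<in> sets (\<Pi>\<^sub>M i\<in>{1..n}. borel)"
proof -
  have "rejected \<zeta> n \<theta> \<phi> i = (\<lambda>x. real (\<phi> x i)) -` (- {0}) \<inter> space (\<Pi>\<^sub>M i\<in>{1..n}. borel)"
    by (auto simp: rejected_def obs_law_def)
  also have "\<dots> \<in> sets (\<Pi>\<^sub>M i\<in>{1..n}. borel)"
    by (rule measurable_sets[OF procedures_measurable[OF assms]]) auto
  finally show ?thesis .
qed

section \<open>The cost of a single error\<close>

lemma FDR_nonneg: "FDR \<zeta> n \<theta> \<phi> \<ge> 0"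
  unfolding FDR_def by (intro integral_nonneg_AE AE_I2 divide_nonneg_nonneg sum_nonneg) auto

lemma FNR_nonneg:
  assumes "\<phi> \<in> procedures n"
  shows "FNR \<zeta> n \<theta> \<phi> \<ge> 0"
  unfolding FNR_def
proof (intro integral_nonneg_AE AE_I2 divide_nonneg_nonneg sum_nonneg)
  fix x i assume "x \<in> space (obs_law \<zeta> n \<theta>)" "i \<in> {1..n}"
  from procedures_cases[OF assms this(2,1)]
  show "0 \<le> of_bool (\<theta> i \<noteq> 0) * (1 - real (\<phi> x i))" by auto
qed simp

text \<open>If \<open>i\<close> is falsely rejected, there are \<open>V \<ge> 1\<close> false
  rejections and at most \<open>s = card (supp n \<theta>)\<close> correct ones, so the false
  discovery proportion is at least \<open>V / (V + s) \<ge> 1 / (1 + s)\<close>.\<close>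

lemma FDR_ge:
  assumes \<zeta>: "\<zeta> > 1" and \<phi>: "\<phi> \<in> procedures n" and i: "i \<in> {1..n}" and null: "\<theta> i = 0"
  shows "1 / (1 + card (supp n \<theta>)) * measure (obs_law \<zeta> n \<theta>) (rejected \<zeta> n \<theta> \<phi> i) \<le> FDR \<zeta> n \<theta> \<phi>"
proof -
  interpret prob_space "obs_law \<zeta> n \<theta>" by (rule prob_space_obs_law) fact
  note meas = procedures_measurable[OF \<phi>, where h = real]
  let ?V = "\<lambda>x. \<Sum>j=1..n. of_bool (\<theta> j = 0) * real (\<phi> x j)"
  let ?R = "\<lambda>x. \<Sum>j=1..n. real (\<phi> x j)"
  have V_le: "?V x \<le> ?R x" for x by (intro sum_mono) auto
  show ?thesis unfolding FDR_def
  proof (rule expectation_ge_prob[where B = 1])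
    show "(\<lambda>x. ?V x / max 1 (?R x)) \<in> borel_measurable (obs_law \<zeta> n \<theta>)"
      unfolding measurable_cong_sets[OF sets_obs_law refl]
      by (intro borel_measurable_divide borel_measurable_sum borel_measurable_max
          borel_measurable_times meas) auto
    show "rejected \<zeta> n \<theta> \<phi> i \<in> events"
      using rejected_measurable[OF \<phi> i] by (simp add: sets_obs_law)
    show "0 \<le> ?V x / max 1 (?R x)" for x
      by (intro divide_nonneg_nonneg sum_nonneg) auto
    show "?V x / max 1 (?R x) \<le> 1" for x
      using V_le[of x] by (subst divide_le_eq_1_pos) (auto intro: order_trans)
    fix x assume "x \<in> rejected \<zeta> n \<theta> \<phi> i"
    then have x: "x \<in> space (obs_law \<zeta> n \<theta>)" and "\<phi> x i \<noteq> 0"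
      by (auto simp: rejected_def)
    then have rej: "\<phi> x i = 1"
      using procedures_cases[OF \<phi> i x] by simp
    have "of_bool (\<theta> i = 0) * real (\<phi> x i) \<le> ?V x"
      using i by (intro member_le_sum) auto
    then have V1: "1 \<le> ?V x" using null rej by simp
    have "?R x = ?V x + (\<Sum>j=1..n. of_bool (\<theta> j \<noteq> 0) * real (\<phi> x j))"
      by (subst sum.distrib[symmetric]) (auto intro!: sum.cong)
    also have "(\<Sum>j=1..n. of_bool (\<theta> j \<noteq> 0) * real (\<phi> x j)) \<le> (\<Sum>j=1..n. of_bool (\<theta> j \<noteq> 0))"
      using procedures_cases[OF \<phi> _ x] by (intro sum_mono) force
    also have "\<dots> = real (card (supp n \<theta>))"
      by (simp add: supp_def Int_def)
    finally have R: "?R x \<le> ?V x + card (supp n \<theta>)" by simp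
    \<comment> \<open>From \<open>V \<ge> 1\<close> one gets \<open>s \<le> s * V\<close>, which
      turns the bound \<open>V + s\<close> on the number of rejections into
      \<open>V * (1 + s)\<close>.\<close>
    have "real (card (supp n \<theta>)) * 1 \<le> real (card (supp n \<theta>)) * ?V x"
      using V1 by (intro mult_left_mono) auto
    then have "max 1 (?R x) \<le> ?V x * (1 + real (card (supp n \<theta>)))"
      using R V1 by (simp add: algebra_simps)
    then show "1 / (1 + card (supp n \<theta>)) \<le> ?V x / max 1 (?R x)"
      by (simp add: field_simps)
  qed
qed

text \<open>A missed signal at \<open>i\<close> contributes one term to the numerator; since
  \<open>i\<close> is in the support, the truncated denominator is the cardinality itself.\<close>

lemma FNR_ge:
  assumes \<zeta>: "\<zeta> > 1" and \<phi>: "\<phi> \<in> procedures n" and i: "i \<in> {1..n}" and signal: "\<theta> i \<noteq> 0"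
  shows "1 / card (supp n \<theta>) * measure (obs_law \<zeta> n \<theta>) (space (obs_law \<zeta> n \<theta>) - rejected \<zeta> n \<theta> \<phi> i)
    \<le> FNR \<zeta> n \<theta> \<phi>"
proof -
  interpret prob_space "obs_law \<zeta> n \<theta>" by (rule prob_space_obs_law) fact
  note meas = procedures_measurable[OF \<phi>, where h = real]
  let ?T = "\<lambda>x. \<Sum>j=1..n. of_bool (\<theta> j \<noteq> 0) * (1 - real (\<phi> x j))"
  have "i \<in> supp n \<theta>" "finite (supp n \<theta>)"
    using i signal by (auto simp: supp_def)
  then have "card (supp n \<theta>) > 0" by (auto simp: card_gt_0_iff)
  then have max1: "max 1 (real (card (supp n \<theta>))) = card (supp n \<theta>)" by simp
  have nn: "0 \<le> of_bool (\<theta> j \<noteq> 0) * (1 - real (\<phi> x j))"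
    if "j \<in> {1..n}" "x \<in> space (obs_law \<zeta> n \<theta>)" for j x
    using procedures_cases[OF \<phi> that] by auto
  show ?thesis unfolding FNR_def max1
  proof (rule expectation_ge_prob[where B = 1])
    show "(\<lambda>x. ?T x / card (supp n \<theta>)) \<in> borel_measurable (obs_law \<zeta> n \<theta>)"
      unfolding measurable_cong_sets[OF sets_obs_law refl]
      by (intro borel_measurable_divide borel_measurable_sum borel_measurable_times
          borel_measurable_diff meas) auto
    show "space (obs_law \<zeta> n \<theta>) - rejected \<zeta> n \<theta> \<phi> i \<in> events"
      using rejected_measurable[OF \<phi> i] by (intro sets.Diff sets.top) (simp add: sets_obs_law)
    fix x
    show "0 \<le> ?T x / card (supp n \<theta>)" if "x \<in> space (obs_law \<zeta> n \<theta>)"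
      using nn that by (intro divide_nonneg_nonneg sum_nonneg) auto
    have "?T x \<le> (\<Sum>j=1..n. of_bool (\<theta> j \<noteq> 0))"
      by (intro sum_mono) auto
    also have "\<dots> = real (card (supp n \<theta>))"
      by (simp add: supp_def Int_def)
    finally show "?T x / card (supp n \<theta>) \<le> 1"
      by (simp add: divide_le_eq)
    assume x: "x \<in> space (obs_law \<zeta> n \<theta>) - rejected \<zeta> n \<theta> \<phi> i"
    then have "of_bool (\<theta> i \<noteq> 0) * (1 - real (\<phi> x i)) \<le> ?T x"
      using i nn by (intro member_le_sum) auto
    then have "1 \<le> ?T x" using signal x by (simp add: rejected_def)
    then show "1 / card (supp n \<theta>) \<le> ?T x / card (supp n \<theta>)"
      by (simp add: divide_right_mono)
  qed
qed

text \<open>The condition on \<open>A\<close> says that coordinate \<open>i\<close> is misclassified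
  there, whichever way, so false rejections and missed signals are both covered; each costs
  1.\<close>

lemma risk_C_ge:
  assumes \<zeta>: "\<zeta> > 1" and \<phi>: "\<phi> \<in> procedures n" and i: "i \<in> {1..n}"
    and A: "A \<in> sets (\<Pi>\<^sub>M i\<in>{1..n}. borel)"
    and err: "\<And>x. x \<in> A \<Longrightarrow> (\<theta> i = 0) = (\<phi> x i \<noteq> 0)"
  shows "measure (obs_law \<zeta> n \<theta>) A \<le> risk_C \<zeta> n \<theta> \<phi>"
proof -
  interpret prob_space "obs_law \<zeta> n \<theta>" by (rule prob_space_obs_law) fact
  let ?l = "\<lambda>x j. of_bool (\<theta> j = 0) * of_bool (\<phi> x j \<noteq> 0) + of_bool (\<theta> j \<noteq> 0) * of_bool (\<phi> x j = 0) :: real"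
  have "1 * prob A \<le> risk_C \<zeta> n \<theta> \<phi>"
    unfolding risk_C_def loss_C_def
  proof (rule expectation_ge_prob[where B = n])
    show "(\<lambda>x. \<Sum>j=1..n. ?l x j) \<in> borel_measurable (obs_law \<zeta> n \<theta>)"
      unfolding measurable_cong_sets[OF sets_obs_law refl]
      by (intro borel_measurable_sum borel_measurable_add borel_measurable_times
          procedures_measurable[OF \<phi>, of _ "\<lambda>d. of_bool (d \<noteq> 0)"]
          procedures_measurable[OF \<phi>, of _ "\<lambda>d. of_bool (d = 0)"]) auto
    show "A \<in> events" using A by (simp add: sets_obs_law)
    fix x
    show "0 \<le> (\<Sum>j=1..n. ?l x j)" by (intro sum_nonneg) auto
    have "(\<Sum>j=1..n. ?l x j) \<le> (\<Sum>j=1..n. 1)" by (intro sum_mono) auto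
    then show "(\<Sum>j=1..n. ?l x j) \<le> n" by simp
    assume "x \<in> A"
    then have "1 = ?l x i" using err[of x] by auto
    also have "\<dots> \<le> (\<Sum>j=1..n. ?l x j)" using i by (intro member_le_sum) auto
    finally show "1 \<le> (\<Sum>j=1..n. ?l x j)" .
  qed
  then show ?thesis by simp
qed

section \<open>The two-parameter minimax bound\<close>

text \<open>Stated for an abstract risk \<open>\<rho>\<close> with normalisation \<open>v\<close> so
  that it serves both risks; \<open>K\<close> is a lower bound for the cost of one error. By the
  dichotomy every procedure errs at \<open>i\<close> under \<open>\<theta>\<close> or under
  \<open>\<theta>(i := m)\<close>, and \<open>L\<close> lies below the normalised cost in either
  case.\<close>

lemma minimax_two_classes_ge:
  fixes \<rho> :: "(nat \<Rightarrow> real) \<Rightarrow> ((nat \<Rightarrow> real) \<Rightarrow> nat \<Rightarrow> nat) \<Rightarrow> real" and v :: "real \<Rightarrow> real"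
  assumes \<zeta>: "\<zeta> > 1" and i: "i \<in> {1..n}" and null: "\<theta> i = 0" and m: "m \<ge> 1"
    and class1: "\<theta> \<in> C r\<^sub>1" and class2: "\<theta>(i := m) \<in> C r\<^sub>2"
    and v: "v r\<^sub>1 > 0" "v r\<^sub>2 > 0" and K: "K \<ge> 0"
    and false_rejection: "\<And>\<phi>. \<phi> \<in> procedures n \<Longrightarrow>
      K * measure (obs_law \<zeta> n \<theta>) (rejected \<zeta> n \<theta> \<phi> i) \<le> \<rho> \<theta> \<phi>"
    and missed_signal: "\<And>\<phi>. \<phi> \<in> procedures n \<Longrightarrow>
      K * measure (obs_law \<zeta> n (\<theta>(i := m)))
          (space (obs_law \<zeta> n (\<theta>(i := m))) - rejected \<zeta> n (\<theta>(i := m)) \<phi> i)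
        \<le> \<rho> (\<theta>(i := m)) \<phi>"
    and L1: "L \<le> K * (exp (- (m powr \<zeta>) / \<zeta>) * (measure (subbotin \<zeta>) {-1..0} / 2)) / v r\<^sub>1"
    and L2: "L \<le> K * (measure (subbotin \<zeta>) {-1..0} / 2) / v r\<^sub>2"
  shows "ereal L \<le> (INF \<phi>\<in>procedures n. MAX r\<in>{r\<^sub>1, r\<^sub>2}. SUP \<theta>\<in>C r. ereal (\<rho> \<theta> \<phi> / v r))"
proof (rule INF_greatest)
  fix \<phi> assume \<phi>: "\<phi> \<in> procedures n"
  have same: "rejected \<zeta> n (\<theta>(i := m)) \<phi> i = rejected \<zeta> n \<theta> \<phi> i"
    by (simp add: rejected_def obs_law_def)
  have "L \<le> \<rho> \<theta> \<phi> / v r\<^sub>1 \<or> L \<le> \<rho> (\<theta>(i := m)) \<phi> / v r\<^sub>2"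
    using obs_law_error_dichotomy[OF \<zeta> i rejected_measurable[OF \<phi> i, of \<zeta> \<theta>], where \<theta> = \<theta>, OF null m]
  proof
    assume "measure (subbotin \<zeta>) {-1..0} / 2 \<le> measure (obs_law \<zeta> n (\<theta>(i := m)))
      (space (obs_law \<zeta> n (\<theta>(i := m))) - rejected \<zeta> n \<theta> \<phi> i)"
    then have "K * (measure (subbotin \<zeta>) {-1..0} / 2) \<le> \<rho> (\<theta>(i := m)) \<phi>"
      using missed_signal[OF \<phi>] K unfolding same by (meson mult_left_mono order_trans)
    then have "K * (measure (subbotin \<zeta>) {-1..0} / 2) / v r\<^sub>2 \<le> \<rho> (\<theta>(i := m)) \<phi> / v r\<^sub>2"
      using v by (intro divide_right_mono) auto
    then show ?thesis using L2 by linarith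
  next
    assume "exp (- (m powr \<zeta>) / \<zeta>) * (measure (subbotin \<zeta>) {-1..0} / 2)
      \<le> measure (obs_law \<zeta> n \<theta>) (rejected \<zeta> n \<theta> \<phi> i)"
    then have "K * (exp (- (m powr \<zeta>) / \<zeta>) * (measure (subbotin \<zeta>) {-1..0} / 2)) \<le> \<rho> \<theta> \<phi>"
      using false_rejection[OF \<phi>] K by (meson mult_left_mono order_trans)
    then have "K * (exp (- (m powr \<zeta>) / \<zeta>) * (measure (subbotin \<zeta>) {-1..0} / 2)) / v r\<^sub>1
        \<le> \<rho> \<theta> \<phi> / v r\<^sub>1"
      using v by (intro divide_right_mono) auto
    then show ?thesis using L1 by linarith
  qed
  \<comment> \<open>Which class realises the bound depends on \<open>\<phi>\<close>; the maximum
    over the two classes covers both cases.\<close>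
  then have "ereal L \<le> (SUP \<theta>\<in>C r\<^sub>1. ereal (\<rho> \<theta> \<phi> / v r\<^sub>1)) \<or>
      ereal L \<le> (SUP \<theta>\<in>C r\<^sub>2. ereal (\<rho> \<theta> \<phi> / v r\<^sub>2))"
    using SUP_upper2[OF class1, of "ereal L" "\<lambda>\<theta>. ereal (\<rho> \<theta> \<phi> / v r\<^sub>1)"]
      SUP_upper2[OF class2, of "ereal L" "\<lambda>\<theta>. ereal (\<rho> \<theta> \<phi> / v r\<^sub>2)"] by auto
  then show "ereal L \<le> (MAX r\<in>{r\<^sub>1, r\<^sub>2}. SUP \<theta>\<in>C r. ereal (\<rho> \<theta> \<phi> / v r))"
    by (simp add: le_max_iff_disj)
qed

section \<open>Rates, signal levels and neighbouring parameters\<close>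

lemma rate_R_pos: "n \<ge> 2 \<Longrightarrow> rate_R n r \<beta> \<zeta> > 0"
  by (simp add: rate_R_def)

text \<open>The level is calibrated so that its power \<open>\<zeta>\<close> is
  \<open>\<zeta> * r * ln n\<close>; hence the likelihood factor is exactly a power of
  \<open>n\<close>.\<close>

lemma exp_signal_level:
  assumes "\<zeta> > 0" "r > 0" "n \<ge> 1"
  shows "exp (- (signal_level \<zeta> n r powr \<zeta>) / \<zeta>) = real n powr (- r)"
  using assms by (simp add: signal_level_def powr_powr powr_def)

lemma sparse_classI:
  assumes "\<theta> \<in> {1..n} \<rightarrow>\<^sub>E UNIV"
    and "a * real n powr (1 - \<beta>) \<le> card (supp n \<theta>)" "card (supp n \<theta>) \<le> b * real n powr (1 - \<beta>)"
    and "\<And>i. i \<in> supp n \<theta> \<Longrightarrow> signal_level \<zeta> n r \<le> \<bar>\<theta> i\<bar>"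
  shows "\<theta> \<in> sparse_class \<zeta> a b n r \<beta>"
  using assms by (auto simp: sparse_class_def)

text \<open>Supplies the two parameters. Signals at the level of \<open>r\<^sub>1\<close> also
  exceed the lower level of \<open>r\<^sub>2\<close>, so adding one weak signal leads into the
  second class, provided both sparsities \<open>s\<close> and \<open>s + 1\<close> are
  admissible.\<close>

lemma eventually_neighbouring_signals:
  fixes \<zeta> \<beta> a b r\<^sub>1 r\<^sub>2 :: real
  assumes \<zeta>: "\<zeta> > 1" and \<beta>: "0 < \<beta>" "\<beta> < 1" and ab: "0 < a" "a < b" and r: "0 < r\<^sub>2" "r\<^sub>2 < r\<^sub>1"
  shows "\<forall>\<^sub>F n in sequentially. n \<ge> 2 \<and> signal_level \<zeta> n r\<^sub>2 \<ge> 1 \<and>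
    (\<exists>\<theta> i. i \<in> {1..n} \<and> \<theta> i = 0 \<and> \<theta> \<in> sparse_class \<zeta> a b n r\<^sub>1 \<beta>
      \<and> \<theta>(i := signal_level \<zeta> n r\<^sub>2) \<in> sparse_class \<zeta> a b n r\<^sub>2 \<beta>)"
proof -
  \<comment> \<open>The margin 2 consists of one unit for rounding up to an integer and one for the
    added signal; it exists eventually because \<open>a < b\<close> and
    \<open>\<beta> < 1\<close>.\<close>
  have "filterlim (\<lambda>n. (b - a) * real n powr (1 - \<beta>)) at_top sequentially"
    using \<beta> ab by real_asymp
  then have room: "\<forall>\<^sub>F n in sequentially. 2 \<le> (b - a) * real n powr (1 - \<beta>)"
    by (simp add: filterlim_at_top)
  \<comment> \<open>This gives \<open>s < n\<close>, so that a null coordinate \<open>Suc s\<close>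
    remains; it relies on \<open>\<beta> > 0\<close>.\<close>
  have "filterlim (\<lambda>n. real n - a * real n powr (1 - \<beta>)) at_top sequentially"
    using \<beta> ab by real_asymp
  then have fits: "\<forall>\<^sub>F n in sequentially. 2 \<le> real n - a * real n powr (1 - \<beta>)"
    by (simp add: filterlim_at_top)
  \<comment> \<open>This yields a level of at least 1, as the shift comparison requires.\<close>
  have "filterlim (\<lambda>n. \<zeta> * r\<^sub>2 * ln (real n)) at_top sequentially"
    using \<zeta> r by real_asymp
  then have large: "\<forall>\<^sub>F n in sequentially. 1 \<le> \<zeta> * r\<^sub>2 * ln (real n)"
    by (simp add: filterlim_at_top)
  show ?thesis
    using room fits large eventually_ge_at_top[of 2]
  proof eventually_elim
    case (elim n)
    define N where "N = real n powr (1 - \<beta>)"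
    define s where "s = nat \<lceil>a * N\<rceil>"
    define M1 where "M1 = signal_level \<zeta> n r\<^sub>1"
    define M2 where "M2 = signal_level \<zeta> n r\<^sub>2"
    define \<theta> where "\<theta> = (\<lambda>j\<in>{1..n}. if j \<le> s then M1 else 0)"
    have "a * N \<ge> 0" using ab by (simp add: N_def)
    then have s: "a * N \<le> s" "s \<le> a * N + 1" unfolding s_def by linarith+
    then have sb: "real s + 1 \<le> b * N" and sn: "s < n"
      using elim(1,2) by (auto simp: N_def[symmetric] algebra_simps)
    have M2: "M2 \<ge> 1"
      using elim(3) \<zeta> by (simp add: M2_def signal_level_def ge_one_powr_ge_zero)
    have "M2 \<le> M1"
      unfolding M1_def M2_def signal_level_def
      using elim(3,4) r \<zeta> by (intro powr_mono2 mult_right_mono mult_left_mono) auto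
    note M = M2 this
    have supp1: "supp n \<theta> = {1..s}"
      using M sn by (auto simp: supp_def \<theta>_def)
    have supp2: "supp n (\<theta>(Suc s := M2)) = {1..Suc s}"
      using M sn by (auto simp: supp_def \<theta>_def le_Suc_eq)
    have "\<theta> \<in> sparse_class \<zeta> a b n r\<^sub>1 \<beta>"
    proof (rule sparse_classI)
      show "signal_level \<zeta> n r\<^sub>1 \<le> \<bar>\<theta> i\<bar>" if "i \<in> supp n \<theta>" for i
        using that sn unfolding supp1 by (auto simp: \<theta>_def M1_def)
      show "\<theta> \<in> {1..n} \<rightarrow>\<^sub>E UNIV" by (simp add: \<theta>_def)
    qed (use s sb in \<open>auto simp: supp1 N_def\<close>)
    moreover have "\<theta>(Suc s := M2) \<in> sparse_class \<zeta> a b n r\<^sub>2 \<beta>"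
    proof (rule sparse_classI)
      show "signal_level \<zeta> n r\<^sub>2 \<le> \<bar>(\<theta>(Suc s := M2)) i\<bar>" if "i \<in> supp n (\<theta>(Suc s := M2))" for i
        using that sn M unfolding supp2 by (auto simp: \<theta>_def M2_def)
      show "\<theta>(Suc s := M2) \<in> {1..n} \<rightarrow>\<^sub>E UNIV"
        using sn by (auto simp: \<theta>_def PiE_def extensional_def)
    qed (use s sb in \<open>auto simp: supp2 N_def\<close>)
    moreover have "Suc s \<in> {1..n}" "\<theta> (Suc s) = 0"
      using sn by (auto simp: \<theta>_def)
    ultimately show ?case
      using elim(4) M2 unfolding M2_def by blast
  qed
qed

lemma card_supp_sparse_class:
  "\<theta> \<in> sparse_class \<zeta> a b n r \<beta> \<Longrightarrow> card (supp n \<theta>) \<le> b * real n powr (1 - \<beta>)"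
  by (auto simp: sparse_class_def)

lemma card_supp_add_signal:
  assumes "i \<in> {1..n}" "\<theta> i = 0" "m \<noteq> 0"
  shows "card (supp n (\<theta>(i := m))) = 1 + card (supp n \<theta>)"
proof -
  have "supp n (\<theta>(i := m)) = insert i (supp n \<theta>)" "i \<notin> supp n \<theta>" "finite (supp n \<theta>)"
    using assms by (auto simp: supp_def)
  then show ?thesis by simp
qed

section \<open>Lower bounds for the two risks\<close>

lemma minimax_R_ge:
  fixes \<zeta> \<beta> a b r\<^sub>1 r\<^sub>2 :: real
  assumes \<zeta>: "\<zeta> > 1" and \<beta>: "0 < \<beta>" "\<beta> < 1" and ab: "0 < a" "a < b" and r: "0 < r\<^sub>2" "r\<^sub>2 < r\<^sub>1"
  shows "\<exists>c>0. \<forall>\<^sub>F n in sequentially.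
    ereal (c * min (inverse (rate_C n r\<^sub>1 \<beta> \<zeta>) * real n powr (- r\<^sub>2)) (inverse (rate_C n r\<^sub>2 \<beta> \<zeta>)))
    \<le> (INF \<phi>\<in>procedures n. MAX r\<in>{r\<^sub>1, r\<^sub>2}. SUP \<theta>\<in>sparse_class \<zeta> a b n r \<beta>.
          ereal (risk_R \<zeta> n \<theta> \<phi> / rate_R n r \<beta> \<zeta>))"
proof (intro exI conjI)
  let ?p = "measure (subbotin \<zeta>) {-1..0}"
  \<comment> \<open>The factor \<open>?p / 2\<close> comes from the dichotomy, and \<open>b\<close>
    from the largest sparsity in the class.\<close>
  let ?c = "?p / (2 * b)"
  have p: "?p > 0" using subbotin_interval_pos[OF \<zeta>] by simp
  then show c: "?c > 0" using ab by simp
  show "\<forall>\<^sub>F n in sequentially.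
    ereal (?c * min (inverse (rate_C n r\<^sub>1 \<beta> \<zeta>) * real n powr (- r\<^sub>2)) (inverse (rate_C n r\<^sub>2 \<beta> \<zeta>)))
    \<le> (INF \<phi>\<in>procedures n. MAX r\<in>{r\<^sub>1, r\<^sub>2}. SUP \<theta>\<in>sparse_class \<zeta> a b n r \<beta>.
          ereal (risk_R \<zeta> n \<theta> \<phi> / rate_R n r \<beta> \<zeta>))"
    using eventually_neighbouring_signals[OF assms]
  proof eventually_elim
    case (elim n)
    let ?M = "signal_level \<zeta> n r\<^sub>2"
    let ?min = "min (inverse (rate_C n r\<^sub>1 \<beta> \<zeta>) * real n powr (- r\<^sub>2)) (inverse (rate_C n r\<^sub>2 \<beta> \<zeta>))"
    \<comment> \<open>The reciprocal of the largest admissible sparsity. The support of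
      \<open>\<theta>(i := ?M)\<close> has one element more than that of \<open>\<theta>\<close>, so
      the cost \<open>1 / (1 + s)\<close> of a false rejection at \<open>\<theta>\<close> equals the
      cost of a missed signal at \<open>\<theta>(i := ?M)\<close>, and \<open>K\<close> is below
      both.\<close>
    define K where "K = 1 / (b * real n powr (1 - \<beta>))"
    have n: "n \<ge> 2" and M: "?M \<ge> 1" using elim by auto
    obtain \<theta> i where i: "i \<in> {1..n}" and null: "\<theta> i = 0"
      and class1: "\<theta> \<in> sparse_class \<zeta> a b n r\<^sub>1 \<beta>"
      and class2: "\<theta>(i := ?M) \<in> sparse_class \<zeta> a b n r\<^sub>2 \<beta>"
      using elim by blast
    have K: "K \<ge> 0" using ab by (simp add: K_def)
    have card: "card (supp n (\<theta>(i := ?M))) = 1 + card (supp n \<theta>)"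
      using M by (intro card_supp_add_signal i null) auto
    then have K_le: "K \<le> 1 / card (supp n (\<theta>(i := ?M)))"
      unfolding K_def using card_supp_sparse_class[OF class2] by (intro divide_left_mono) auto
    show ?case
    proof (rule minimax_two_classes_ge[OF \<zeta> i, where \<theta> = \<theta> and m = ?M and K = K
          and C = "\<lambda>r. sparse_class \<zeta> a b n r \<beta>" and \<rho> = "risk_R \<zeta> n"
          and v = "\<lambda>r. rate_R n r \<beta> \<zeta>", OF null M class1 class2 _ _ K])
      fix \<phi> assume \<phi>: "\<phi> \<in> procedures n"
      have "K * measure (obs_law \<zeta> n \<theta>) (rejected \<zeta> n \<theta> \<phi> i)
          \<le> 1 / (1 + card (supp n \<theta>)) * measure (obs_law \<zeta> n \<theta>) (rejected \<zeta> n \<theta> \<phi> i)"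
        using K_le card by (intro mult_right_mono) auto
      also have "\<dots> \<le> FDR \<zeta> n \<theta> \<phi>"
        by (rule FDR_ge[where \<theta> = \<theta>, OF \<zeta> \<phi> i null])
      finally show "K * measure (obs_law \<zeta> n \<theta>) (rejected \<zeta> n \<theta> \<phi> i) \<le> risk_R \<zeta> n \<theta> \<phi>"
        using FNR_nonneg[OF \<phi>, of \<zeta> \<theta>] by (simp add: risk_R_def)
      let ?A = "space (obs_law \<zeta> n (\<theta>(i := ?M))) - rejected \<zeta> n (\<theta>(i := ?M)) \<phi> i"
      have "K * measure (obs_law \<zeta> n (\<theta>(i := ?M))) ?A
          \<le> 1 / card (supp n (\<theta>(i := ?M))) * measure (obs_law \<zeta> n (\<theta>(i := ?M))) ?A"
        using K_le by (intro mult_right_mono) auto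
      also have "\<dots> \<le> FNR \<zeta> n (\<theta>(i := ?M)) \<phi>"
        using M by (intro FNR_ge \<zeta> \<phi> i) auto
      finally show "K * measure (obs_law \<zeta> n (\<theta>(i := ?M))) ?A \<le> risk_R \<zeta> n (\<theta>(i := ?M)) \<phi>"
        using FDR_nonneg[of \<zeta> n "\<theta>(i := ?M)" \<phi>] by (simp add: risk_R_def)
    next
      have "?c * ?min \<le> ?c * (inverse (rate_C n r\<^sub>1 \<beta> \<zeta>) * real n powr (- r\<^sub>2))"
        using c by (intro mult_left_mono) auto
      \<comment> \<open>The factor \<open>n powr (1 - \<beta>)\<close> in \<open>K\<close> turns
        \<open>rate_R\<close> into \<open>rate_C\<close>.\<close>
      also have "\<dots> = K * (real n powr (- r\<^sub>2) * (?p / 2)) / rate_R n r\<^sub>1 \<beta> \<zeta>"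
        by (simp add: K_def rate_C_def field_simps)
      finally show "?c * ?min \<le> K * (exp (- (?M powr \<zeta>) / \<zeta>) * (?p / 2)) / rate_R n r\<^sub>1 \<beta> \<zeta>"
        using \<zeta> r n by (subst exp_signal_level) auto
      have "?c * ?min \<le> ?c * inverse (rate_C n r\<^sub>2 \<beta> \<zeta>)"
        using c by (intro mult_left_mono) auto
      also have "\<dots> = K * (?p / 2) / rate_R n r\<^sub>2 \<beta> \<zeta>"
        by (simp add: K_def rate_C_def field_simps)
      finally show "?c * ?min \<le> K * (?p / 2) / rate_R n r\<^sub>2 \<beta> \<zeta>" .
    qed (use rate_R_pos n in auto)
  qed
qed

text \<open>One error now costs 1 instead of a fraction of order
  \<open>n powr (\<beta> - 1)\<close>, and the normalisation grows by the inverse factor, so the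
  same rate results, with the constant \<open>?p / 2\<close>.\<close>

lemma minimax_C_ge:
  fixes \<zeta> \<beta> a b r\<^sub>1 r\<^sub>2 :: real
  assumes \<zeta>: "\<zeta> > 1" and \<beta>: "0 < \<beta>" "\<beta> < 1" and ab: "0 < a" "a < b" and r: "0 < r\<^sub>2" "r\<^sub>2 < r\<^sub>1"
  shows "\<exists>c>0. \<forall>\<^sub>F n in sequentially.
    ereal (c * min (inverse (rate_C n r\<^sub>1 \<beta> \<zeta>) * real n powr (- r\<^sub>2)) (inverse (rate_C n r\<^sub>2 \<beta> \<zeta>)))
    \<le> (INF \<phi>\<in>procedures n. MAX r\<in>{r\<^sub>1, r\<^sub>2}. SUP \<theta>\<in>sparse_class \<zeta> a b n r \<beta>.
          ereal (risk_C \<zeta> n \<theta> \<phi> / rate_C n r \<beta> \<zeta>))"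
proof (intro exI conjI)
  let ?p = "measure (subbotin \<zeta>) {-1..0}"
  show c: "?p / 2 > 0" using subbotin_interval_pos[OF \<zeta>] by simp
  show "\<forall>\<^sub>F n in sequentially.
    ereal (?p / 2 * min (inverse (rate_C n r\<^sub>1 \<beta> \<zeta>) * real n powr (- r\<^sub>2)) (inverse (rate_C n r\<^sub>2 \<beta> \<zeta>)))
    \<le> (INF \<phi>\<in>procedures n. MAX r\<in>{r\<^sub>1, r\<^sub>2}. SUP \<theta>\<in>sparse_class \<zeta> a b n r \<beta>.
          ereal (risk_C \<zeta> n \<theta> \<phi> / rate_C n r \<beta> \<zeta>))"
    using eventually_neighbouring_signals[OF assms]
  proof eventually_elim
    case (elim n)
    let ?M = "signal_level \<zeta> n r\<^sub>2"
    let ?min = "min (inverse (rate_C n r\<^sub>1 \<beta> \<zeta>) * real n powr (- r\<^sub>2)) (inverse (rate_C n r\<^sub>2 \<beta> \<zeta>))"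
    have n: "n \<ge> 2" and M: "?M \<ge> 1" using elim by auto
    obtain \<theta> i where i: "i \<in> {1..n}" and null: "\<theta> i = 0"
      and class1: "\<theta> \<in> sparse_class \<zeta> a b n r\<^sub>1 \<beta>"
      and class2: "\<theta>(i := ?M) \<in> sparse_class \<zeta> a b n r\<^sub>2 \<beta>"
      using elim by blast
    have rate_pos: "rate_C n r \<beta> \<zeta> > 0" for r
      using rate_R_pos[OF n] n by (simp add: rate_C_def)
    show ?case
    proof (rule minimax_two_classes_ge[OF \<zeta> i, where \<theta> = \<theta> and m = ?M and K = 1
          and C = "\<lambda>r. sparse_class \<zeta> a b n r \<beta>" and \<rho> = "risk_C \<zeta> n"
          and v = "\<lambda>r. rate_C n r \<beta> \<zeta>", OF null M class1 class2 rate_pos rate_pos])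
      fix \<phi> assume \<phi>: "\<phi> \<in> procedures n"
      have "measure (obs_law \<zeta> n \<theta>) (rejected \<zeta> n \<theta> \<phi> i) \<le> risk_C \<zeta> n \<theta> \<phi>"
        using null by (intro risk_C_ge[OF \<zeta> \<phi> i] rejected_measurable \<phi> i) (auto simp: rejected_def)
      then show "1 * measure (obs_law \<zeta> n \<theta>) (rejected \<zeta> n \<theta> \<phi> i) \<le> risk_C \<zeta> n \<theta> \<phi>"
        by simp
      let ?\<theta> = "\<theta>(i := ?M)"
      have "space (obs_law \<zeta> n ?\<theta>) - rejected \<zeta> n ?\<theta> \<phi> i \<in> sets (obs_law \<zeta> n ?\<theta>)"
        using rejected_measurable[OF \<phi> i, of \<zeta> ?\<theta>]
        by (intro sets.Diff sets.top) (simp add: sets_obs_law)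
      then have "measure (obs_law \<zeta> n ?\<theta>) (space (obs_law \<zeta> n ?\<theta>) - rejected \<zeta> n ?\<theta> \<phi> i)
          \<le> risk_C \<zeta> n ?\<theta> \<phi>"
        using M by (intro risk_C_ge[OF \<zeta> \<phi> i]) (auto simp: rejected_def sets_obs_law)
      then show "1 * measure (obs_law \<zeta> n ?\<theta>) (space (obs_law \<zeta> n ?\<theta>) - rejected \<zeta> n ?\<theta> \<phi> i)
          \<le> risk_C \<zeta> n ?\<theta> \<phi>"
        by simp
    next
      have "?p / 2 * ?min \<le> ?p / 2 * (inverse (rate_C n r\<^sub>1 \<beta> \<zeta>) * real n powr (- r\<^sub>2))"
        using c by (intro mult_left_mono) auto
      also have "\<dots> = 1 * (real n powr (- r\<^sub>2) * (?p / 2)) / rate_C n r\<^sub>1 \<beta> \<zeta>"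
        by (simp add: field_simps)
      finally show "?p / 2 * ?min \<le> 1 * (exp (- (?M powr \<zeta>) / \<zeta>) * (?p / 2)) / rate_C n r\<^sub>1 \<beta> \<zeta>"
        using \<zeta> r n by (subst exp_signal_level) auto
      have "?p / 2 * ?min \<le> ?p / 2 * inverse (rate_C n r\<^sub>2 \<beta> \<zeta>)"
        using c by (intro mult_left_mono) auto
      then show "?p / 2 * ?min \<le> 1 * (?p / 2) / rate_C n r\<^sub>2 \<beta> \<zeta>"
        by (simp add: field_simps)
    qed simp
  qed
qed

section \<open>The polynomial loss\<close>

text \<open>Up to a logarithmic factor that is at least 1 for \<open>n \<ge> 3\<close>, the two
  terms of the minimum are powers of \<open>n\<close> with the exponents compared in
  \<open>\<eta>\<close>. Taking half of the smaller one leaves a spare factor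
  \<open>n powr \<eta>\<close> to absorb \<open>c\<close>.\<close>

lemma eventually_polynomial_loss:
  fixes \<zeta> \<beta> c r\<^sub>1 r\<^sub>2 :: real
  assumes \<zeta>: "\<zeta> > 1" and c: "c > 0"
    and k1: "kappa r\<^sub>1 \<beta> \<zeta> - r\<^sub>2 > 1 - \<beta>" and k2: "kappa r\<^sub>2 \<beta> \<zeta> > 1 - \<beta>"
  defines "\<eta> \<equiv> min (kappa r\<^sub>1 \<beta> \<zeta> - r\<^sub>2 - (1 - \<beta>)) (kappa r\<^sub>2 \<beta> \<zeta> - (1 - \<beta>)) / 2"
  shows "\<forall>\<^sub>F n in sequentially. real n powr \<eta> \<le>
    c * min (inverse (rate_C n r\<^sub>1 \<beta> \<zeta>) * real n powr (- r\<^sub>2)) (inverse (rate_C n r\<^sub>2 \<beta> \<zeta>))"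
proof -
  have \<eta>: "\<eta> > 0" using k1 k2 by (simp add: \<eta>_def)
  \<comment> \<open>The exponent \<open>y\<close> is \<open>- r\<^sub>2\<close> for the first term
    of the minimum and 0 for the second.\<close>
  have inv: "real n powr x \<le> inverse (rate_C n r \<beta> \<zeta>) * real n powr y"
    if n: "n \<ge> 3" and x: "x \<le> kappa r \<beta> \<zeta> - (1 - \<beta>) + y" for n r x y
  proof -
    have "exp 1 \<le> real n" using n exp_le by linarith
    then have "1 \<le> ln (real n)" using n by (simp add: ln_ge_iff)
    then have "1 \<le> ln (real n) powr (1 - 1 / \<zeta>)"
      using \<zeta> by (intro ge_one_powr_ge_zero) auto
    then have "real n powr (kappa r \<beta> \<zeta> - (1 - \<beta>) + y) * 1
        \<le> real n powr (kappa r \<beta> \<zeta> - (1 - \<beta>) + y) * ln (real n) powr (1 - 1 / \<zeta>)"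
      by (intro mult_left_mono) auto
    also have "\<dots> = inverse (rate_C n r \<beta> \<zeta>) * real n powr y"
      using n by (simp add: rate_C_def rate_R_def powr_diff powr_add powr_minus field_simps)
    finally have "real n powr (kappa r \<beta> \<zeta> - (1 - \<beta>) + y) \<le> inverse (rate_C n r \<beta> \<zeta>) * real n powr y"
      by simp
    moreover have "real n powr x \<le> real n powr (kappa r \<beta> \<zeta> - (1 - \<beta>) + y)"
      using n x by (intro powr_mono) auto
    ultimately show ?thesis by linarith
  qed
  have "filterlim (\<lambda>n. c * real n powr \<eta>) at_top sequentially"
    using \<eta> c by real_asymp
  then have "\<forall>\<^sub>F n in sequentially. 1 \<le> c * real n powr \<eta>"
    by (simp add: filterlim_at_top)
  then show ?thesis
    using eventually_ge_at_top[of 3]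
  proof eventually_elim
    case (elim n)
    have "real n powr \<eta> * 1 \<le> real n powr \<eta> * (c * real n powr \<eta>)"
      using elim by (intro mult_left_mono) auto
    also have "\<dots> = c * real n powr (2 * \<eta>)"
      by (simp add: powr_add[symmetric])
    also have "\<dots> \<le> c * min (inverse (rate_C n r\<^sub>1 \<beta> \<zeta>) * real n powr (- r\<^sub>2))
        (inverse (rate_C n r\<^sub>2 \<beta> \<zeta>))"
    proof (intro mult_left_mono min.boundedI)
      show "real n powr (2 * \<eta>) \<le> inverse (rate_C n r\<^sub>1 \<beta> \<zeta>) * real n powr (- r\<^sub>2)"
        using elim by (intro inv) (auto simp: \<eta>_def)
      show "real n powr (2 * \<eta>) \<le> inverse (rate_C n r\<^sub>2 \<beta> \<zeta>)"
        using inv[of n "2 * \<eta>" r\<^sub>2 0] elim by (auto simp: \<eta>_def)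
    qed (use c in auto)
    finally show ?case by simp
  qed
qed

theorem mainTheorem9:
  fixes \<zeta> \<beta> a b r\<^sub>1 r\<^sub>2 :: real
  assumes "\<zeta> > 1" and "0 < \<beta>" and "\<beta> < 1" and "0 < a" and "a < b"
    and "r\<^sub>1 > \<beta>" and "r\<^sub>2 > \<beta>"
    and "r\<^sub>1 > r\<^sub>2" and "kappa r\<^sub>2 \<beta> \<zeta> > 1 - \<beta>"
  shows "(\<exists>c>0. \<forall>\<^sub>F n in sequentially.
             (INF \<phi>\<in>procedures n. MAX r\<in>{r\<^sub>1, r\<^sub>2}. SUP \<theta>\<in>sparse_class \<zeta> a b n r \<beta>.
                ereal (risk_R \<zeta> n \<theta> \<phi> / rate_R n r \<beta> \<zeta>))
             \<ge> ereal (c * min (inverse (rate_C n r\<^sub>1 \<beta> \<zeta>) * real n powr (- r\<^sub>2))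
                               (inverse (rate_C n r\<^sub>2 \<beta> \<zeta>)))) \<and>
         (kappa r\<^sub>1 \<beta> \<zeta> - r\<^sub>2 > 1 - \<beta> \<longrightarrow>
           (\<exists>\<eta>>0. \<forall>\<^sub>F n in sequentially.
             (INF \<phi>\<in>procedures n. MAX r\<in>{r\<^sub>1, r\<^sub>2}. SUP \<theta>\<in>sparse_class \<zeta> a b n r \<beta>.
                ereal (risk_R \<zeta> n \<theta> \<phi> / rate_R n r \<beta> \<zeta>))
             \<ge> ereal (real n powr \<eta>))) \<and>
         (\<exists>c>0. \<forall>\<^sub>F n in sequentially.
             (INF \<phi>\<in>procedures n. MAX r\<in>{r\<^sub>1, r\<^sub>2}. SUP \<theta>\<in>sparse_class \<zeta> a b n r \<beta>.
                ereal (risk_C \<zeta> n \<theta> \<phi> / rate_C n r \<beta> \<zeta>))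
             \<ge> ereal (c * min (inverse (rate_C n r\<^sub>1 \<beta> \<zeta>) * real n powr (- r\<^sub>2))
                               (inverse (rate_C n r\<^sub>2 \<beta> \<zeta>)))) \<and>
         (kappa r\<^sub>1 \<beta> \<zeta> - r\<^sub>2 > 1 - \<beta> \<longrightarrow>
           (\<exists>\<eta>>0. \<forall>\<^sub>F n in sequentially.
             (INF \<phi>\<in>procedures n. MAX r\<in>{r\<^sub>1, r\<^sub>2}. SUP \<theta>\<in>sparse_class \<zeta> a b n r \<beta>.
                ereal (risk_C \<zeta> n \<theta> \<phi> / rate_C n r \<beta> \<zeta>))
             \<ge> ereal (real n powr \<eta>)))"
proof -
  let ?min = "\<lambda>n. min (inverse (rate_C n r\<^sub>1 \<beta> \<zeta>) * real n powr (- r\<^sub>2)) (inverse (rate_C n r\<^sub>2 \<beta> \<zeta>))"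
  \<comment> \<open>With \<open>F\<close> standing for the minimax quantity, a single deduction
    covers both risks.\<close>
  have loss: "\<exists>\<eta>>0. \<forall>\<^sub>F n in sequentially. ereal (real n powr \<eta>) \<le> F n"
    if F: "\<exists>c>0. \<forall>\<^sub>F n in sequentially. ereal (c * ?min n) \<le> F n"
      and k: "kappa r\<^sub>1 \<beta> \<zeta> - r\<^sub>2 > 1 - \<beta>" for F :: "nat \<Rightarrow> ereal"
  proof -
    obtain c where "c > 0" and c: "\<forall>\<^sub>F n in sequentially. ereal (c * ?min n) \<le> F n"
      using F by blast
    define \<eta> where "\<eta> = min (kappa r\<^sub>1 \<beta> \<zeta> - r\<^sub>2 - (1 - \<beta>)) (kappa r\<^sub>2 \<beta> \<zeta> - (1 - \<beta>)) / 2"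
    have "\<forall>\<^sub>F n in sequentially. real n powr \<eta> \<le> c * ?min n"
      unfolding \<eta>_def using assms k \<open>c > 0\<close> by (intro eventually_polynomial_loss) auto
    with c have "\<forall>\<^sub>F n in sequentially. ereal (real n powr \<eta>) \<le> F n"
      by eventually_elim (meson ereal_less_eq(3) order_trans)
    moreover have "\<eta> > 0" using assms k by (simp add: \<eta>_def)
    ultimately show ?thesis by blast
  qed
  have r2: "0 < r\<^sub>2" using assms by simp
  note R = minimax_R_ge[OF assms(1-5) r2 assms(8)]
  note C = minimax_C_ge[OF assms(1-5) r2 assms(8)]
  show ?thesis
    using R C loss[OF R] loss[OF C] by blast
qed

end
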